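(* Let $G$ and $H$ be finitely generated groups with finite symmetric generating sets $S$ and $T$, respectively, neither containing the identity. Let $M$ be a finite connected graph that does not contain cut-vertices. If $M$ is a minor of $\mathrm{Cay}(G*H,S\cup T)$, where $G*H$ is the free product of $G$ and $H$, then $M$ is a minor of either $\mathrm{Cay}(G,S)$ or $\mathrm{Cay}(H,T)$.
   Context: Cayley graph: for a group $G$ and a finite generating set $S$ that is symmetric ($s\in S$ iff $s^{-1}\in S$) and does not contain the identity, $\mathrm{Cay}(G,S)$ is the graph with vertex set $G$ in which $u,v\in G$ are adjacent if and only if $u=sv$ for some $s\in S$. In the free product $G*H$, the groups $G$ and $H$ (and hence $S$ and $T$) are identified with their canonical images, so $S\cup T$ is a generating set of $G*H$. Minor: a finite graph $M$ is a minor of a connected graph $\Gamma$ if there is a finite set $\{V_i\}$ of pairwise-disjoint (nonempty) finite connected subgraphs of $\Gamma$ (branch sets), in one-to-one correspondence with the set of vertices $\{v_i\}$ of $M$, such that for every edge of $M$ between $v_i$ and $v_j$ there is an edge of $\Gamma$ between $V_i$ and $V_j$. A cut-vertex in a graph is a vertex whose deletion increases the number of connected components. *)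

theory Defs
  imports "Graph_Theory.Digraph_Component" "HOL-Algebra.Generated_Groups"
begin

section \<open>Free products of groups\<close>

text \<open>
  The free product is realised on reduced words: lists of non-identity syllables, taken
  alternately from the two factors. The empty word is the identity.
\<close>

definition reduced_words ::
    "('a, 'c) monoid_scheme \<Rightarrow> ('b, 'd) monoid_scheme \<Rightarrow> ('a + 'b) list set" where
  "reduced_words G H =
    {w. set w \<subseteq> Inl ` (carrier G - {\<one>\<^bsub>G\<^esub>}) \<union> Inr ` (carrier H - {\<one>\<^bsub>H\<^esub>}) \<and>
        successively (\<lambda>x y. isl x \<noteq> isl y) w}"

text \<open>Left multiplication of a reduced word by one (non-identity) syllable.\<close>

fun syllable_mult ::
    "('a, 'c) monoid_scheme \<Rightarrow> ('b, 'd) monoid_scheme \<Rightarrow> 'a + 'b \<Rightarrow> ('a + 'b) list \<Rightarrow> ('a + 'b) list"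
  where
  "syllable_mult G H (Inl g) (Inl g' # w) =
     (if g \<otimes>\<^bsub>G\<^esub> g' = \<one>\<^bsub>G\<^esub> then w else Inl (g \<otimes>\<^bsub>G\<^esub> g') # w)"
| "syllable_mult G H (Inr h) (Inr h' # w) =
     (if h \<otimes>\<^bsub>H\<^esub> h' = \<one>\<^bsub>H\<^esub> then w else Inr (h \<otimes>\<^bsub>H\<^esub> h') # w)"
| "syllable_mult G H x w = x # w"

definition free_product ::
    "('a, 'c) monoid_scheme \<Rightarrow> ('b, 'd) monoid_scheme \<Rightarrow> ('a + 'b) list monoid" where
  "free_product G H =
    \<lparr>carrier = reduced_words G H, mult = foldr (syllable_mult G H), one = []\<rparr>"

definition free_product_inl :: "('a, 'c) monoid_scheme \<Rightarrow> 'a \<Rightarrow> ('a + 'b) list" where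
  "free_product_inl G g = (if g = \<one>\<^bsub>G\<^esub> then [] else [Inl g])"

definition free_product_inr :: "('b, 'd) monoid_scheme \<Rightarrow> 'b \<Rightarrow> ('a + 'b) list" where
  "free_product_inr H h = (if h = \<one>\<^bsub>H\<^esub> then [] else [Inr h])"

section \<open>Cayley graphs\<close>

text \<open>
  Undirected graphs are symmetric digraphs, as in the library's locale \<^locale>\<open>graph\<close>:
  an edge between \<open>u\<close> and \<open>v\<close> is a pair of opposite arcs.
\<close>

definition cayley_generating_set :: "('a, 'c) monoid_scheme \<Rightarrow> 'a set \<Rightarrow> bool" where
  "cayley_generating_set G S \<longleftrightarrow>
     finite S \<and> S \<subseteq> carrier G \<and> generate G S = carrier G \<and>
     (\<forall>s \<in> carrier G. s \<in> S \<longleftrightarrow> inv\<^bsub>G\<^esub> s \<in> S) \<and> \<one>\<^bsub>G\<^esub> \<notin> S"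

definition cayley_graph :: "('a, 'c) monoid_scheme \<Rightarrow> 'a set \<Rightarrow> ('a, 'a \<times> 'a) pre_digraph" where
  "cayley_graph G S = with_proj
     \<lparr>pverts = carrier G,
      parcs = {(u, v). u \<in> carrier G \<and> v \<in> carrier G \<and> (\<exists>s \<in> S. u = s \<otimes>\<^bsub>G\<^esub> v)}\<rparr>"

section \<open>Minors and cut-vertices\<close>

text \<open>
  The predicate \<^const>\<open>Digraph_Component.connected\<close> includes non-emptiness of the vertex set.
\<close>

definition is_minor :: "('v, 'e) pre_digraph \<Rightarrow> ('w, 'f) pre_digraph \<Rightarrow> bool" where
  "is_minor M \<Gamma> \<longleftrightarrow>
     (\<exists>B :: 'v \<Rightarrow> ('w, 'f) pre_digraph.
        (\<forall>v \<in> verts M. subgraph (B v) \<Gamma> \<and> graph (B v) \<and> Digraph_Component.connected (B v)) \<and>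
        (\<forall>u \<in> verts M. \<forall>v \<in> verts M. u \<noteq> v \<longrightarrow> verts (B u) \<inter> verts (B v) = {}) \<and>
        (\<forall>u v. u \<rightarrow>\<^bsub>M\<^esub> v \<longrightarrow> (\<exists>x \<in> verts (B u). \<exists>y \<in> verts (B v). x \<rightarrow>\<^bsub>\<Gamma>\<^esub> y)))"

text \<open>
  In a symmetric digraph the strongly connected components are the connected components.
\<close>

definition cut_vertex :: "('v, 'e) pre_digraph \<Rightarrow> 'v \<Rightarrow> bool" where
  "cut_vertex M v \<longleftrightarrow> v \<in> verts M \<and>
     card (pre_digraph.sccs M) < card (pre_digraph.sccs (pre_digraph.del_vert M v))"

section \<open>Basic facts\<close>

lemma reduced_words_Nil [simp]: "[] \<in> reduced_words G H"
  by (simp add: reduced_words_def)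

lemma reduced_words_Inl_Cons:
  "Inl g # w \<in> reduced_words G H \<longleftrightarrow>
     g \<in> carrier G \<and> g \<noteq> \<one>\<^bsub>G\<^esub> \<and> w \<in> reduced_words G H \<and> (w = [] \<or> \<not> isl (hd w))"
  by (cases w) (auto simp: reduced_words_def)

lemma reduced_words_Inr_Cons:
  "Inr h # w \<in> reduced_words G H \<longleftrightarrow>
     h \<in> carrier H \<and> h \<noteq> \<one>\<^bsub>H\<^esub> \<and> w \<in> reduced_words G H \<and> (w = [] \<or> isl (hd w))"
  by (cases w) (auto simp: reduced_words_def)

lemmas reduced_words_Cons = reduced_words_Inl_Cons reduced_words_Inr_Cons

lemma reduced_words_ConsD:
  assumes "x # w \<in> reduced_words G H"
  shows "w \<in> reduced_words G H" "[x] \<in> reduced_words G H"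
  using assms by (cases x; simp add: reduced_words_Cons)+

lemma syllable_mult_Cons_reduced:
  assumes "x # w \<in> reduced_words G H"
  shows "syllable_mult G H x w = x # w"
  using assms by (cases "(G, H, x, w)" rule: syllable_mult.cases) (auto simp: reduced_words_Cons)

locale group_pair = G: group G + H: group H
  for G :: "('a, 'c) monoid_scheme" and H :: "('b, 'd) monoid_scheme"
begin

lemma syllable_mult_closed:
  assumes "[x] \<in> reduced_words G H" "w \<in> reduced_words G H"
  shows "syllable_mult G H x w \<in> reduced_words G H"
  using assms
  by (cases "(G, H, x, w)" rule: syllable_mult.cases) (auto simp: reduced_words_Cons)

lemma foldr_closed:
  assumes "u \<in> reduced_words G H" "w \<in> reduced_words G H"
  shows "foldr (syllable_mult G H) u w \<in> reduced_words G H"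
  using assms(1)
proof (induction u)
  case (Cons x u)
  then show ?case using reduced_words_ConsD[OF Cons.prems] by (simp add: syllable_mult_closed)
qed (simp add: assms(2))

lemma syllable_mult_Inl_Inl:
  assumes "[Inl a] \<in> reduced_words G H" "[Inl b] \<in> reduced_words G H" "w \<in> reduced_words G H"
  shows "syllable_mult G H (Inl a) (syllable_mult G H (Inl b) w) =
    (if a \<otimes>\<^bsub>G\<^esub> b = \<one>\<^bsub>G\<^esub> then w else syllable_mult G H (Inl (a \<otimes>\<^bsub>G\<^esub> b)) w)"
proof (cases w)
  case Nil
  then show ?thesis by simp
next
  case (Cons y w')
  show ?thesis
  proof (cases y)
    case (Inr h)
    then show ?thesis using Cons by simp
  next
    case (Inl c)
    have ab: "a \<in> carrier G" "b \<in> carrier G" "c \<in> carrier G" "a \<noteq> \<one>\<^bsub>G\<^esub>" "b \<noteq> \<one>\<^bsub>G\<^esub>" "c \<noteq> \<one>\<^bsub>G\<^esub>"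
      using assms Cons Inl by (auto simp: reduced_words_Cons)
    have w': "w' = [] \<or> (\<exists>h w''. w' = Inr h # w'')"
    proof (cases w')
      case (Cons z zs)
      then show ?thesis using assms(3) \<open>w = y # w'\<close> Inl
        by (cases z) (auto simp: reduced_words_Cons)
    qed simp
    have as: "(a \<otimes>\<^bsub>G\<^esub> b) \<otimes>\<^bsub>G\<^esub> c = a \<otimes>\<^bsub>G\<^esub> (b \<otimes>\<^bsub>G\<^esub> c)" using ab by (simp add: G.m_assoc)
    show ?thesis
    proof (cases "b \<otimes>\<^bsub>G\<^esub> c = \<one>\<^bsub>G\<^esub>")
      case True
      have 1: "(a \<otimes>\<^bsub>G\<^esub> b) \<otimes>\<^bsub>G\<^esub> c = a" using as True ab by simp
      have 2: "a \<otimes>\<^bsub>G\<^esub> b = \<one>\<^bsub>G\<^esub> \<Longrightarrow> a = c" using 1 ab by simp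
      show ?thesis using w' Cons Inl True 1 2 ab by auto
    next
      case False
      have 2: "a \<otimes>\<^bsub>G\<^esub> b = \<one>\<^bsub>G\<^esub> \<Longrightarrow> a \<otimes>\<^bsub>G\<^esub> (b \<otimes>\<^bsub>G\<^esub> c) = c" using as ab by simp
      show ?thesis using Cons Inl False as 2 ab by auto
    qed
  qed
qed

lemma syllable_mult_Inr_Inr:
  assumes "[Inr a] \<in> reduced_words G H" "[Inr b] \<in> reduced_words G H" "w \<in> reduced_words G H"
  shows "syllable_mult G H (Inr a) (syllable_mult G H (Inr b) w) =
    (if a \<otimes>\<^bsub>H\<^esub> b = \<one>\<^bsub>H\<^esub> then w else syllable_mult G H (Inr (a \<otimes>\<^bsub>H\<^esub> b)) w)"
proof (cases w)
  case Nil
  then show ?thesis by simp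
next
  case (Cons y w')
  show ?thesis
  proof (cases y)
    case (Inl h)
    then show ?thesis using Cons by simp
  next
    case (Inr c)
    have ab: "a \<in> carrier H" "b \<in> carrier H" "c \<in> carrier H" "a \<noteq> \<one>\<^bsub>H\<^esub>" "b \<noteq> \<one>\<^bsub>H\<^esub>" "c \<noteq> \<one>\<^bsub>H\<^esub>"
      using assms Cons Inr by (auto simp: reduced_words_Cons)
    have w': "w' = [] \<or> (\<exists>h w''. w' = Inl h # w'')"
    proof (cases w')
      case (Cons z zs)
      then show ?thesis using assms(3) \<open>w = y # w'\<close> Inr
        by (cases z) (auto simp: reduced_words_Cons)
    qed simp
    have as: "(a \<otimes>\<^bsub>H\<^esub> b) \<otimes>\<^bsub>H\<^esub> c = a \<otimes>\<^bsub>H\<^esub> (b \<otimes>\<^bsub>H\<^esub> c)" using ab by (simp add: H.m_assoc)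
    show ?thesis
    proof (cases "b \<otimes>\<^bsub>H\<^esub> c = \<one>\<^bsub>H\<^esub>")
      case True
      have 1: "(a \<otimes>\<^bsub>H\<^esub> b) \<otimes>\<^bsub>H\<^esub> c = a" using as True ab by simp
      have 2: "a \<otimes>\<^bsub>H\<^esub> b = \<one>\<^bsub>H\<^esub> \<Longrightarrow> a = c" using 1 ab by simp
      show ?thesis using w' Cons Inr True 1 2 ab by auto
    next
      case False
      have 2: "a \<otimes>\<^bsub>H\<^esub> b = \<one>\<^bsub>H\<^esub> \<Longrightarrow> a \<otimes>\<^bsub>H\<^esub> (b \<otimes>\<^bsub>H\<^esub> c) = c" using as ab by simp
      show ?thesis using Cons Inr False as 2 ab by auto
    qed
  qed
qed

lemma foldr_syllable_mult:
  assumes "[x] \<in> reduced_words G H" "w \<in> reduced_words G H" "z \<in> reduced_words G H"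
  shows "foldr (syllable_mult G H) (syllable_mult G H x w) z =
    syllable_mult G H x (foldr (syllable_mult G H) w z)"
proof (cases w)
  case Nil
  then show ?thesis by (cases x) simp_all
next
  case (Cons y w')
  have y: "[y] \<in> reduced_words G H" and w': "w' \<in> reduced_words G H"
    using reduced_words_ConsD assms(2) Cons by blast+
  note z = foldr_closed[OF w' assms(3)]
  show ?thesis
  proof (cases x)
    case x: (Inl a)
    show ?thesis
    proof (cases y)
      case (Inl b)
      then show ?thesis using Cons x y syllable_mult_Inl_Inl[OF _ _ z, of a b] assms(1) by simp
    qed (use Cons x in simp)
  next
    case x: (Inr a)
    show ?thesis
    proof (cases y)
      case (Inr b)
      then show ?thesis using Cons x y syllable_mult_Inr_Inr[OF _ _ z, of a b] assms(1) by simp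
    qed (use Cons x in simp)
  qed
qed

lemma foldr_assoc:
  assumes "u \<in> reduced_words G H" "w \<in> reduced_words G H" "z \<in> reduced_words G H"
  shows "foldr (syllable_mult G H) (foldr (syllable_mult G H) u w) z =
    foldr (syllable_mult G H) u (foldr (syllable_mult G H) w z)"
  using assms(1)
proof (induction u)
  case (Cons x u)
  note x = reduced_words_ConsD[OF Cons.prems]
  show ?case
    using Cons.IH[OF x(1)] foldr_syllable_mult[OF x(2) foldr_closed[OF x(1) assms(2)] assms(3)]
    by simp
qed simp

lemma left_inverse:
  assumes "u \<in> reduced_words G H"
  shows "\<exists>v \<in> reduced_words G H. foldr (syllable_mult G H) v u = []"
  using assms
proof (induction u)
  case (Cons x u)
  note x = reduced_words_ConsD[OF Cons.prems]
  obtain v where v: "v \<in> reduced_words G H" "foldr (syllable_mult G H) v u = []"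
    using Cons.IH[OF x(1)] by blast
  obtain x' where x': "[x'] \<in> reduced_words G H" "syllable_mult G H x' (x # u) = u"
  proof (cases x)
    case (Inl a)
    then show ?thesis
      using that[of "Inl (inv\<^bsub>G\<^esub> a)"] x(2) by (auto simp: reduced_words_Cons G.inv_eq_1_iff)
  next
    case (Inr a)
    then show ?thesis
      using that[of "Inr (inv\<^bsub>H\<^esub> a)"] x(2) by (auto simp: reduced_words_Cons H.inv_eq_1_iff)
  qed
  let ?w = "foldr (syllable_mult G H) v [x']"
  have "foldr (syllable_mult G H) ?w (x # u) = foldr (syllable_mult G H) v u"
    using foldr_assoc[OF v(1) x'(1) Cons.prems] x'(2) by simp
  then show ?case using foldr_closed[OF v(1) x'(1)] v(2) by metis
qed (auto intro: bexI[of _ "[]"])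

lemma group_free_product: "group (free_product G H)"
  by (rule groupI) (auto simp: free_product_def foldr_closed foldr_assoc left_inverse)

lemma free_product_inl_hom: "free_product_inl G \<in> hom G (free_product G H)"
  by (auto simp: hom_def free_product_def free_product_inl_def reduced_words_Cons)

lemma free_product_inr_hom: "free_product_inr H \<in> hom H (free_product G H)"
  by (auto simp: hom_def free_product_def free_product_inr_def reduced_words_Cons)

text \<open>The universal property of the free product.\<close>

lemma free_product_lift:
  fixes K :: "('k, 'm) monoid_scheme"
  assumes "group K" "f \<in> hom G K" "h \<in> hom H K"
  shows "\<exists>\<phi> \<in> hom (free_product G H) K.
    (\<forall>a \<in> carrier G. \<phi> (free_product_inl G a) = f a) \<and>
    (\<forall>b \<in> carrier H. \<phi> (free_product_inr H b) = h b)"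
proof -
  interpret K: group K by fact
  interpret f: group_hom G K f by unfold_locales (rule assms)
  interpret h: group_hom H K h by unfold_locales (rule assms)
  define \<phi> where "\<phi> = (\<lambda>w. foldr (\<lambda>x k. case_sum f h x \<otimes>\<^bsub>K\<^esub> k) w \<one>\<^bsub>K\<^esub>)"
  have \<phi>_Nil: "\<phi> [] = \<one>\<^bsub>K\<^esub>" and \<phi>_Cons: "\<phi> (x # w) = case_sum f h x \<otimes>\<^bsub>K\<^esub> \<phi> w" for x w
    by (simp_all add: \<phi>_def)
  have letter: "case_sum f h x \<in> carrier K" if "[x] \<in> reduced_words G H" for x
    using that by (cases x) (auto simp: reduced_words_Cons)
  have closed: "\<phi> w \<in> carrier K" if "w \<in> reduced_words G H" for w
    using that
  proof (induction w)
    case (Cons x w)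
    then show ?case using reduced_words_ConsD[OF Cons.prems] letter by (simp add: \<phi>_Cons)
  qed (simp add: \<phi>_Nil)
  have syl: "\<phi> (syllable_mult G H x w) = case_sum f h x \<otimes>\<^bsub>K\<^esub> \<phi> w"
    if "[x] \<in> reduced_words G H" "w \<in> reduced_words G H" for x w
  proof (cases w)
    case Nil
    then show ?thesis by (cases x) (simp_all add: \<phi>_Cons)
  next
    case (Cons y w')
    have y: "[y] \<in> reduced_words G H" and w': "\<phi> w' \<in> carrier K"
      using reduced_words_ConsD that(2) Cons closed by blast+
    show ?thesis
    proof (cases x)
      case x: (Inl a)
      show ?thesis
      proof (cases y)
        case (Inl b)
        have ab: "a \<in> carrier G" "b \<in> carrier G"
          using that(1) y x Inl by (auto simp: reduced_words_Cons)
        have "f (a \<otimes>\<^bsub>G\<^esub> b) \<otimes>\<^bsub>K\<^esub> \<phi> w' = f a \<otimes>\<^bsub>K\<^esub> (f b \<otimes>\<^bsub>K\<^esub> \<phi> w')"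
          using ab w' by (simp add: K.m_assoc)
        then show ?thesis using Cons x Inl w' ab
          by (cases "a \<otimes>\<^bsub>G\<^esub> b = \<one>\<^bsub>G\<^esub>") (simp_all add: \<phi>_Cons del: f.hom_mult)
      qed (use Cons x in \<open>simp add: \<phi>_Cons\<close>)
    next
      case x: (Inr a)
      show ?thesis
      proof (cases y)
        case (Inr b)
        have ab: "a \<in> carrier H" "b \<in> carrier H"
          using that(1) y x Inr by (auto simp: reduced_words_Cons)
        have "h (a \<otimes>\<^bsub>H\<^esub> b) \<otimes>\<^bsub>K\<^esub> \<phi> w' = h a \<otimes>\<^bsub>K\<^esub> (h b \<otimes>\<^bsub>K\<^esub> \<phi> w')"
          using ab w' by (simp add: K.m_assoc)
        then show ?thesis using Cons x Inr w' ab
          by (cases "a \<otimes>\<^bsub>H\<^esub> b = \<one>\<^bsub>H\<^esub>") (simp_all add: \<phi>_Cons del: h.hom_mult)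
      qed (use Cons x in \<open>simp add: \<phi>_Cons\<close>)
    qed
  qed
  have mult: "\<phi> (foldr (syllable_mult G H) u w) = \<phi> u \<otimes>\<^bsub>K\<^esub> \<phi> w"
    if "u \<in> reduced_words G H" "w \<in> reduced_words G H" for u w
    using that(1)
  proof (induction u)
    case (Cons x u)
    note x = reduced_words_ConsD[OF Cons.prems]
    show ?case
      using syl[OF x(2) foldr_closed[OF x(1) that(2)]] Cons.IH[OF x(1)]
        letter[OF x(2)] closed[OF x(1)] closed[OF that(2)]
      by (simp add: \<phi>_Cons K.m_assoc)
  qed (simp add: \<phi>_Nil closed that(2))
  have "\<phi> \<in> hom (free_product G H) K"
    using closed mult by (auto simp: hom_def free_product_def)
  moreover have "\<phi> (free_product_inl G a) = f a" if "a \<in> carrier G" for a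
    using that by (simp add: free_product_inl_def \<phi>_Nil \<phi>_Cons)
  moreover have "\<phi> (free_product_inr H b) = h b" if "b \<in> carrier H" for b
    using that by (simp add: free_product_inr_def \<phi>_Nil \<phi>_Cons)
  ultimately show ?thesis by blast
qed

lemma free_product_lift_unique:
  fixes K :: "('k, 'm) monoid_scheme"
  assumes "group K" "\<phi> \<in> hom (free_product G H) K" "\<psi> \<in> hom (free_product G H) K"
    and "\<And>a. a \<in> carrier G \<Longrightarrow> \<phi> (free_product_inl G a) = \<psi> (free_product_inl G a)"
    and "\<And>b. b \<in> carrier H \<Longrightarrow> \<phi> (free_product_inr H b) = \<psi> (free_product_inr H b)"
    and "w \<in> carrier (free_product G H)"
  shows "\<phi> w = \<psi> w"
proof -
  interpret P: group "free_product G H" by (rule group_free_product)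
  interpret K: group K by fact
  interpret \<phi>: group_hom "free_product G H" K \<phi> by unfold_locales (rule assms)
  interpret \<psi>: group_hom "free_product G H" K \<psi> by unfold_locales (rule assms)
  have "w \<in> reduced_words G H" using assms(6) by (simp add: free_product_def)
  then show ?thesis
  proof (induction w)
    case Nil
    then show ?case using \<phi>.hom_one \<psi>.hom_one by (simp add: free_product_def)
  next
    case (Cons x w)
    note x = reduced_words_ConsD[OF Cons.prems]
    have eq: "x # w = [x] \<otimes>\<^bsub>free_product G H\<^esub> w"
      using syllable_mult_Cons_reduced[OF Cons.prems] by (simp add: free_product_def)
    have "[x] \<in> carrier (free_product G H)" "w \<in> carrier (free_product G H)"
      using x by (simp_all add: free_product_def)
    moreover have "\<phi> [x] = \<psi> [x]"
    proof (cases x)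
      case (Inl a)
      then show ?thesis using assms(4)[of a] x(2)
        by (auto simp: free_product_inl_def reduced_words_Cons)
    next
      case (Inr b)
      then show ?thesis using assms(5)[of b] x(2)
        by (auto simp: free_product_inr_def reduced_words_Cons)
    qed
    ultimately show ?case using Cons.IH[OF x(1)] eq by simp
  qed
qed

end

lemma wf_digraph_cayley_graph: "wf_digraph (cayley_graph G S)"
  by unfold_locales (auto simp: cayley_graph_def)

lemma cayley_graph_adj:
  "u \<rightarrow>\<^bsub>cayley_graph G S\<^esub> v \<longleftrightarrow>
     u \<in> carrier G \<and> v \<in> carrier G \<and> (\<exists>s \<in> S. u = s \<otimes>\<^bsub>G\<^esub> v)"
  by (simp add: cayley_graph_def)

lemma cayley_generating_setD:
  assumes "cayley_generating_set G S" "s \<in> S"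
  shows "s \<in> carrier G" "s \<noteq> \<one>\<^bsub>G\<^esub>" "inv\<^bsub>G\<^esub> s \<in> S"
  using assms unfolding cayley_generating_set_def by blast+

lemma symmetric_cayley_graph:
  assumes "group G" "cayley_generating_set G S"
  shows "symmetric (cayley_graph G S)"
proof -
  interpret group G by fact
  have "v \<rightarrow>\<^bsub>cayley_graph G S\<^esub> u" if adj: "u \<rightarrow>\<^bsub>cayley_graph G S\<^esub> v" for u v
  proof -
    obtain s where s: "s \<in> S" "u = s \<otimes>\<^bsub>G\<^esub> v" "u \<in> carrier G" "v \<in> carrier G"
      using adj by (auto simp: cayley_graph_adj)
    note S = cayley_generating_setD[OF assms(2) s(1)]
    have "v = inv\<^bsub>G\<^esub> s \<otimes>\<^bsub>G\<^esub> u"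
      using s S(1) by (simp add: m_assoc[symmetric])
    then show ?thesis using s S(3) unfolding cayley_graph_adj by blast
  qed
  then show ?thesis unfolding symmetric_def by (rule symI)
qed

lemma loopfree_cayley_graph:
  assumes "group G" "cayley_generating_set G S"
  shows "loopfree_digraph (cayley_graph G S)"
proof -
  interpret group G by fact
  interpret wf_digraph "cayley_graph G S" by (rule wf_digraph_cayley_graph)
  have "tail (cayley_graph G S) e \<noteq> head (cayley_graph G S) e"
    if e: "e \<in> arcs (cayley_graph G S)" for e
  proof
    assume "tail (cayley_graph G S) e = head (cayley_graph G S) e"
    then obtain s v where s: "s \<in> S" "v = s \<otimes>\<^bsub>G\<^esub> v" "v \<in> carrier G"
      using e by (cases e) (auto simp: cayley_graph_def)
    show False
      using s(2)[symmetric] s(3) cayley_generating_setD[OF assms(2) s(1)] by simp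
  qed
  then show ?thesis by unfold_locales
qed

end

theory Submission
  imports Defs
begin

text \<open>
  The Cayley graph of \<open>G * H\<close> is a tree-like arrangement of copies of the two factor graphs (the
  cosets), and every vertex separates the two cosets through it. Since \<open>M\<close> has no cut-vertex, the
  branch sets of a model of \<open>M\<close> that avoid a given vertex all lie on one side of it. Following these
  sides leads to a single coset that meets every branch set. The nearest-point projection onto that
  coset maps each branch set into itself, so the projected branch sets still form a model of \<open>M\<close>.
\<close>

section \<open>Connected vertex sets and minor models\<close>

text \<open>Stated for a bare vertex set, with paths confined to \<open>X\<close>, so that the image
  of a set under a projection can be handled without choosing arcs.\<close>

definition connected_in :: "('w \<Rightarrow> 'w \<Rightarrow> bool) \<Rightarrow> 'w set \<Rightarrow> bool" where
  "connected_in E X \<longleftrightarrow>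
     X \<noteq> {} \<and> (\<forall>x\<in>X. \<forall>y\<in>X. (\<lambda>a b. E a b \<and> a \<in> X \<and> b \<in> X)\<^sup>*\<^sup>* x y)"

text \<open>Branch sets are vertex sets instead of subgraphs. When the host is symmetric, loop-free
  and without parallel arcs, the induced subgraphs lead back to \<open>is_minor\<close>.\<close>

definition minor_model ::
    "('v, 'e) pre_digraph \<Rightarrow> ('w \<Rightarrow> 'w \<Rightarrow> bool) \<Rightarrow> ('v \<Rightarrow> 'w set) \<Rightarrow> bool" where
  "minor_model M E X \<longleftrightarrow>
     (\<forall>v \<in> verts M. finite (X v) \<and> connected_in E (X v)) \<and>
     (\<forall>u \<in> verts M. \<forall>v \<in> verts M. u \<noteq> v \<longrightarrow> X u \<inter> X v = {}) \<and>
     (\<forall>u v. u \<rightarrow>\<^bsub>M\<^esub> v \<longrightarrow> (\<exists>x \<in> X u. \<exists>y \<in> X v. E x y))"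

text \<open>Induction along a path inside \<open>X\<close>. Later choices of \<open>P\<close> say,
  for example, that a point lies on one side of a vertex or that its gate lies in
  \<open>X\<close>.\<close>

lemma connected_in_invariant:
  assumes "connected_in E X" "x \<in> X" "P x" "y \<in> X"
    and step: "\<And>a b. E a b \<Longrightarrow> a \<in> X \<Longrightarrow> b \<in> X \<Longrightarrow> P a \<Longrightarrow> P b"
  shows "P y"
proof -
  have "(\<lambda>a b. E a b \<and> a \<in> X \<and> b \<in> X)\<^sup>*\<^sup>* x y"
    using assms(1,2,4) by (simp add: connected_in_def)
  then show ?thesis
    by (induction) (use assms(3) step in blast)+
qed

section \<open>Passage between branch subgraphs and branch vertex sets\<close>

lemma reachable_imp_rtranclp:
  assumes "u \<rightarrow>\<^sup>*\<^bsub>D\<^esub> v" "\<And>a b. a \<rightarrow>\<^bsub>D\<^esub> b \<Longrightarrow> R a b"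
  shows "R\<^sup>*\<^sup>* u v"
proof -
  have "(u, v) \<in> (arcs_ends D)\<^sup>*"
    using assms(1) by (auto simp: reachable_def intro: rtrancl_on_rtranclI)
  then show ?thesis
    by (induction) (use assms(2) in \<open>auto intro: rtranclp.rtrancl_into_rtrancl\<close>)
qed

lemma connected_in_if_strongly_connected:
  assumes "wf_digraph D" "strongly_connected D" "\<And>a b. a \<rightarrow>\<^bsub>D\<^esub> b \<Longrightarrow> E a b"
  shows "connected_in E (verts D)"
  unfolding connected_in_def
proof (intro conjI ballI)
  show "verts D \<noteq> {}" using assms(2) by (simp add: strongly_connected_def)
next
  fix x y assume "x \<in> verts D" "y \<in> verts D"
  then have "x \<rightarrow>\<^sup>*\<^bsub>D\<^esub> y" using assms(2) by (simp add: strongly_connected_def)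
  then show "(\<lambda>a b. E a b \<and> a \<in> verts D \<and> b \<in> verts D)\<^sup>*\<^sup>* x y"
    by (rule reachable_imp_rtranclp) (use assms(3) wf_digraph.adj_in_verts[OF assms(1)] in blast)
qed

lemma (in graph) connected_imp_connected_in:
  assumes "Digraph_Component.connected G" "\<And>a b. a \<rightarrow>\<^bsub>G\<^esub> b \<Longrightarrow> E a b"
  shows "connected_in E (verts G)"
  by (rule connected_in_if_strongly_connected)
    (use assms wf_digraph in \<open>auto intro: symmetric_connected_imp_strongly_connected sym_arcs\<close>)

lemma is_minor_imp_minor_model:
  assumes "is_minor M D"
  obtains X where "minor_model M (dominates D) X" "\<And>v. v \<in> verts M \<Longrightarrow> X v \<subseteq> verts D"
proof -
  obtain B where B:
    "\<And>v. v \<in> verts M \<Longrightarrow> subgraph (B v) D \<and> graph (B v) \<and> Digraph_Component.connected (B v)"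
    "\<forall>u \<in> verts M. \<forall>v \<in> verts M. u \<noteq> v \<longrightarrow> verts (B u) \<inter> verts (B v) = {}"
    "\<forall>u v. u \<rightarrow>\<^bsub>M\<^esub> v \<longrightarrow> (\<exists>x \<in> verts (B u). \<exists>y \<in> verts (B v). x \<rightarrow>\<^bsub>D\<^esub> y)"
    using assms unfolding is_minor_def by blast
  have "finite (verts (B v)) \<and> connected_in (dominates D) (verts (B v))" if "v \<in> verts M" for v
  proof -
    interpret graph "B v" using B(1)[OF that] by simp
    show ?thesis
      using B(1)[OF that] connected_imp_connected_in[of "dominates D"] pre_digraph.adj_mono
      by fastforce
  qed
  then have "minor_model M (dominates D) (\<lambda>v. verts (B v))"
    using B(2,3) unfolding minor_model_def by blast
  moreover have "verts (B v) \<subseteq> verts D" if "v \<in> verts M" for v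
    using B(1)[OF that] by (auto simp: subgraph_def)
  ultimately show ?thesis using that by blast
qed

lemma minor_model_imp_is_minor:
  assumes "sym_digraph D" "loopfree_digraph D" "nomulti_digraph D"
    and X: "minor_model M (dominates D) X" and sub: "\<And>v. v \<in> verts M \<Longrightarrow> X v \<subseteq> verts D"
  shows "is_minor M D"
proof -
  interpret sym_digraph D by fact
  interpret loopfree_digraph D by fact
  interpret nomulti_digraph D by fact
  have adj: "a \<rightarrow>\<^bsub>D \<restriction> Y\<^esub> b \<longleftrightarrow> a \<rightarrow>\<^bsub>D\<^esub> b \<and> a \<in> Y \<and> b \<in> Y" for a b Y
    by (auto simp: arcs_ends_def arc_to_ends_def)
  have "graph (D \<restriction> X v) \<and> Digraph_Component.connected (D \<restriction> X v)" if v: "v \<in> verts M" for v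
  proof -
    have fin: "finite (X v)" and con: "connected_in (dominates D) (X v)"
      using X v by (auto simp: minor_model_def)
    \<comment> \<open>Without parallel arcs an arc is determined by its ends, so finitely many
      vertices span only finitely many arcs.\<close>
    have "arc_to_ends D ` {e \<in> arcs D. tail D e \<in> X v \<and> head D e \<in> X v} \<subseteq> X v \<times> X v"
      by (auto simp: arc_to_ends_def)
    moreover have "inj_on (arc_to_ends D) {e \<in> arcs D. tail D e \<in> X v \<and> head D e \<in> X v}"
      using no_multi_arcs by (auto intro: inj_onI)
    ultimately have "finite {e \<in> arcs D. tail D e \<in> X v \<and> head D e \<in> X v}"
      using fin by (meson finite_SigmaI inj_on_finite)
    then have "graph (D \<restriction> X v)"
      using fin sub[OF v] no_loops no_multi_arcs sym_arcs
      by unfold_locales (auto simp: arc_to_ends_def adj symmetric_def sym_def)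
    then interpret B: graph "D \<restriction> X v" .
    have "a \<rightarrow>\<^sup>*\<^bsub>D \<restriction> X v\<^esub> b" if "a \<in> X v" "b \<in> X v" for a b
    proof -
      have "(\<lambda>a b. a \<rightarrow>\<^bsub>D\<^esub> b \<and> a \<in> X v \<and> b \<in> X v)\<^sup>*\<^sup>* a b"
        using con that by (simp add: connected_in_def)
      then show ?thesis
      proof induction
        case base
        then show ?case using that by simp
      next
        case (step y z)
        then have "y \<rightarrow>\<^bsub>D \<restriction> X v\<^esub> z" by (simp add: adj)
        with step.IH show ?case by (rule B.reachable_adj_trans)
      qed
    qed
    then have "strongly_connected (D \<restriction> X v)"
      using con by (auto simp: strongly_connected_def connected_in_def)
    \<comment> \<open>Connectedness of a digraph means strong connectedness of its symmetrisation,
      which reaches at least as much.\<close>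
    then show ?thesis using \<open>graph (D \<restriction> X v)\<close> B.reachable_mk_symmetricI
      by (auto simp: Digraph_Component.connected_def strongly_connected_def)
  qed
  moreover have "subgraph (D \<restriction> X v) D" if "v \<in> verts M" for v
    using sub[OF that] by (intro induced_imp_subgraph induced_induce)
  ultimately show ?thesis
    using X unfolding is_minor_def minor_model_def
    by (intro exI[of _ "\<lambda>v. D \<restriction> X v"]) simp
qed

lemma minor_model_cayley_graph:
  assumes "group G" "cayley_generating_set G S"
    and "minor_model M (dominates (cayley_graph G S)) X"
    and "\<And>v. v \<in> verts M \<Longrightarrow> X v \<subseteq> carrier G"
  shows "is_minor M (cayley_graph G S)"
proof (rule minor_model_imp_is_minor[OF _ _ _ assms(3)])
  interpret wf_digraph "cayley_graph G S" by (rule wf_digraph_cayley_graph)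
  show "sym_digraph (cayley_graph G S)"
    by unfold_locales (rule symmetric_cayley_graph[OF assms(1,2)])
  show "loopfree_digraph (cayley_graph G S)"
    by (rule loopfree_cayley_graph[OF assms(1,2)])
  show "nomulti_digraph (cayley_graph G S)"
    by unfold_locales (simp add: cayley_graph_def arc_to_ends_def)
qed (use assms(4) in \<open>simp add: cayley_graph_def\<close>)

section \<open>Graphs without cut-vertices\<close>

text \<open>A component is determined by its vertex set, a subset of \<open>verts G\<close>.
  Finiteness matters because cut-vertices are defined through \<open>card\<close>, which is 0 on
  infinite sets.\<close>

lemma (in wf_digraph) finite_sccs:
  assumes "finite (verts G)"
  shows "finite sccs"
proof -
  have "sccs_verts \<subseteq> Pow (verts G)"
    unfolding sccs_verts_def using reachable_in_verts by blast
  then have "finite (verts ` sccs)"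
    using assms sccs_verts_conv by (metis finite_Pow_iff finite_subset)
  then show ?thesis using inj_on_verts_sccs finite_imageD by blast
qed

text \<open>A connected graph has one component, so deleting a vertex that is not a cut-vertex
  leaves at most one. The assumption \<open>verts G \<noteq> {v}\<close> keeps the remainder
  nonempty, as \<open>connected_in\<close> requires.\<close>

lemma (in graph) connected_in_del_vert:
  assumes "Digraph_Component.connected G" "\<not> cut_vertex G v" "v \<in> verts G" "verts G \<noteq> {v}"
  shows "connected_in (dominates G) (verts G - {v})"
proof -
  have sc: "strongly_connected G" using symmetric_connected_imp_strongly_connected[OF sym_arcs assms(1)] .
  interpret D: fin_digraph "del_vert v" by (rule fin_digraph_del_vert)
  have "card sccs = 1" using sc by (simp add: strongly_connected_eq_iff)
  then have le: "card D.sccs \<le> 1"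
    using assms(2,3) by (simp add: cut_vertex_def)
  have sym: "symmetric (del_vert v)"
    using sym_arcs unfolding symmetric_def sym_def arcs_ends_def arc_to_ends_def
    by (fastforce simp: del_vert_simps)
  interpret D: sym_digraph "del_vert v" by unfold_locales (rule sym)
  have "a \<rightarrow>\<^sup>*\<^bsub>del_vert v\<^esub> b" if ab: "a \<in> verts (del_vert v)" "b \<in> verts (del_vert v)" for a b
  proof -
    \<comment> \<open>In a symmetric digraph the set reachable from a vertex induces a strong
      component, and \<open>le\<close> allows only one component.\<close>
    have "(del_vert v \<restriction> {x. a \<rightarrow>\<^sup>*\<^bsub>del_vert v\<^esub> x}) = (del_vert v \<restriction> {x. b \<rightarrow>\<^sup>*\<^bsub>del_vert v\<^esub> x})"
      using le D.finite_sccs[OF D.finite_verts]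
        D.induce_reachable_is_in_sccs[OF ab(1)] D.induce_reachable_is_in_sccs[OF ab(2)]
      by (metis One_nat_def card_le_Suc0_iff_eq)
    then have "{x. a \<rightarrow>\<^sup>*\<^bsub>del_vert v\<^esub> x} = {x. b \<rightarrow>\<^sup>*\<^bsub>del_vert v\<^esub> x}"
      by (metis induce_subgraph_verts)
    then show ?thesis using ab D.reachable_refl by blast
  qed
  then have "strongly_connected (del_vert v)"
    using assms(3,4) by (auto simp: strongly_connected_def del_vert_simps)
  then have "connected_in (dominates G) (verts (del_vert v))"
    by (rule connected_in_if_strongly_connected[OF D.wf_digraph])
      (use adj_mono subgraph_del_vert in blast)
  then show ?thesis by (simp add: del_vert_simps)
qed

section \<open>Words in a free product as a tree of cosets\<close>

text \<open>These are the possible effects of left multiplication by one syllable: the first letter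
  is removed, added, or replaced within its factor. Forgetting the group elements turns separation
  into list combinatorics.\<close>

definition adjacent_words :: "('a + 'b) list \<Rightarrow> ('a + 'b) list \<Rightarrow> bool" where
  "adjacent_words y y' \<longleftrightarrow>
     (\<exists>a. y = a # y') \<or> (\<exists>a. y' = a # y) \<or> (\<exists>a b w. y = a # w \<and> y' = b # w \<and> isl a = isl b)"

text \<open>
  The parameter \<open>t\<close> selects the factor: \<open>True\<close> stands for letters from \<open>G\<close>. The set \<open>below t w\<close> is
  the branch hanging off \<open>w\<close> in that factor, and \<open>gate t w\<close> is the nearest-point projection onto
  \<open>coset_words t w\<close>.
\<close>

definition below :: "bool \<Rightarrow> ('a + 'b) list \<Rightarrow> ('a + 'b) list set" where
  "below t w = {z @ c # w | z c. isl c = t}"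

text \<open>Words grow at the front, so this models the right coset through \<open>w\<close> of the
  chosen factor, provided that \<open>w\<close> does not begin with a letter of that factor.
  Intersecting with \<open>reduced_words\<close> later restricts the letters to the carrier.\<close>

definition coset_words :: "bool \<Rightarrow> ('a + 'b) list \<Rightarrow> ('a + 'b) list set" where
  "coset_words t w = insert w {c # w | c. isl c = t}"

definition gate :: "bool \<Rightarrow> ('a + 'b) list \<Rightarrow> ('a + 'b) list \<Rightarrow> ('a + 'b) list" where
  "gate t w y =
     (let u = drop (length y - Suc (length w)) y in if u \<in> coset_words t w then u else w)"

lemma adjacent_words_sym: "adjacent_words y y' \<Longrightarrow> adjacent_words y' y"
  unfolding adjacent_words_def by metis

text \<open>The only exit from a branch is its base \<open>x\<close>: changing the first letter of
  \<open>z @ c # x\<close> preserves \<open>c # x\<close> unless \<open>z\<close> is empty, and then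
  \<open>c\<close> can only be replaced within its factor or removed.\<close>

lemma adjacent_words_below:
  assumes "adjacent_words y y'" "y \<in> below t x"
  shows "y' \<in> insert x (below t x)"
proof -
  obtain z c where y: "y = z @ c # x" "isl c = t" using assms(2) by (auto simp: below_def)
  consider a where "y = a # y'" | a where "y' = a # y"
    | a b w where "y = a # w" "y' = b # w" "isl a = isl b"
    using assms(1) unfolding adjacent_words_def by blast
  then show ?thesis
  proof cases
    case 1
    then show ?thesis using y by (cases z) (auto simp: below_def)
  next
    case 2
    then have "y' = (a # z) @ c # x" using y by simp
    then show ?thesis using y(2) unfolding below_def by blast
  next
    case 3
    show ?thesis
    proof (cases z)
      case Nil
      then have "y' = [] @ b # x" "isl b = t" using 3 y by auto
      then show ?thesis unfolding below_def by blast
    next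
      case (Cons d z')
      then have "y' = (b # z') @ c # x" using 3 y by auto
      then show ?thesis using y(2) unfolding below_def by blast
    qed
  qed
qed

section \<open>The projection onto a coset\<close>

lemma gate_below: "isl c = t \<Longrightarrow> gate t w (z @ c # w) = c # w"
  by (simp add: gate_def coset_words_def)

text \<open>The gate inspects the last \<open>Suc (length w)\<close> letters of \<open>y\<close>. If
  it differs from \<open>w\<close>, these letters are \<open>c # w\<close> with \<open>c\<close> in
  the chosen factor, which puts \<open>y\<close> into the branch. For a shorter \<open>y\<close>,
  truncated subtraction drops nothing.\<close>

lemma gate_not_below:
  assumes "y \<notin> below t w"
  shows "gate t w y = w"
proof (rule ccontr)
  assume neq: "gate t w y \<noteq> w"
  let ?u = "drop (length y - Suc (length w)) y"
  have "?u \<in> coset_words t w" "?u \<noteq> w"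
    using neq by (auto simp: gate_def Let_def split: if_splits)
  then obtain c where c: "?u = c # w" "isl c = t" by (auto simp: coset_words_def)
  have "y = take (length y - Suc (length w)) y @ c # w"
    using c(1) append_take_drop_id by metis
  then show False using assms c(2) unfolding below_def by blast
qed

lemma not_below_self: "w \<notin> below t w"
  by (auto simp: below_def)

lemma gate_coset: "y \<in> coset_words t w \<Longrightarrow> gate t w y = y"
  using gate_below[of _ t w "[]"] gate_not_below[OF not_below_self, of t w]
  by (auto simp: coset_words_def)

lemma gate_in_coset: "gate t w y \<in> coset_words t w"
  by (auto simp: gate_def coset_words_def Let_def)

text \<open>The gate depends only on the letter in front of \<open>w\<close>, and an edge changes
  that letter only when both its ends lie in the coset. So the projection collapses each edge or
  fixes both its ends.\<close>

lemma adjacent_words_gate: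
  assumes "adjacent_words y y'"
  shows "gate t w y = gate t w y' \<or> y \<in> coset_words t w \<and> y' \<in> coset_words t w"
proof -
  have *: "gate t w y = gate t w y' \<or> y \<in> coset_words t w \<and> y' \<in> coset_words t w"
    if adj: "adjacent_words y y'" and y': "y' \<notin> below t w" for y y'
  proof (cases "y \<in> below t w")
    case False
    then show ?thesis using y' gate_not_below by metis
  next
    case True
    then have y'w: "y' = w" using adjacent_words_below[OF adj] y' by blast
    obtain z c where y: "y = z @ c # w" "isl c = t" using True by (auto simp: below_def)
    \<comment> \<open>One edge adds at most one letter, so the branch is entered from
      \<open>w\<close> at depth one.\<close>
    have "length y \<le> Suc (length y')" using adj unfolding adjacent_words_def by auto
    then have "z = []" using y y'w by simp
    then show ?thesis using y y'w by (simp add: coset_words_def)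
  qed
  show ?thesis
  proof (cases "y \<in> below t w \<and> y' \<in> below t w")
    case False
    then show ?thesis using *[OF assms] *[OF adjacent_words_sym[OF assms]] by metis
  next
    case True
    then obtain z c z' c' where y: "y = z @ c # w" "isl c = t"
        and y': "y' = z' @ c' # w" "isl c' = t"
      by (auto simp: below_def)
    show ?thesis
    proof (cases "c = c'")
      case True
      then show ?thesis using y y' gate_below by metis
    next
      case False
      \<comment> \<open>Adjacent words that differ directly in front of \<open>w\<close> can only
        arise by replacing a first letter.\<close>
      have "z = [] \<and> z' = []"
        using assms False unfolding adjacent_words_def y(1) y'(1)
        by (cases z; cases z') (auto simp: append_eq_Cons_conv append_eq_append_conv2)
      then show ?thesis using y y' by (auto simp: coset_words_def)
    qed
  qed
qed

text \<open>Walk inside \<open>X\<close> from a point of the coset: each edge either keeps the gate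
  or lies in the coset, where the gate is the point itself. Hence the projections of disjoint branch
  sets stay disjoint.\<close>

lemma connected_in_gate:
  assumes "connected_in E X" "\<And>a b. E a b \<Longrightarrow> adjacent_words a b"
    and "X \<inter> coset_words t w \<noteq> {}" "y \<in> X"
  shows "gate t w y \<in> X"
proof -
  obtain c where c: "c \<in> X" "c \<in> coset_words t w" using assms(3) by blast
  show ?thesis
  proof (rule connected_in_invariant[OF assms(1) c(1) _ assms(4)])
    show "gate t w c \<in> X" using c gate_coset by metis
  next
    fix a b assume "E a b" "a \<in> X" "b \<in> X" "gate t w a \<in> X"
    then show "gate t w b \<in> X"
      using adjacent_words_gate[OF assms(2), of a b t w] gate_coset by metis
  qed
qed

section \<open>Localising a minor model in a coset\<close>

text \<open>A path that enters the branch could leave it only through \<open>x\<close>, which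
  \<open>X\<close> avoids.\<close>

lemma connected_in_below:
  assumes "connected_in E X" "\<And>a b. E a b \<Longrightarrow> adjacent_words a b"
    and "x \<notin> X" "X \<inter> below t x \<noteq> {}"
  shows "X \<subseteq> below t x"
proof
  fix y assume y: "y \<in> X"
  obtain c where c: "c \<in> X" "c \<in> below t x" using assms(4) by blast
  show "y \<in> below t x"
    by (rule connected_in_invariant[where P = "\<lambda>y. y \<in> below t x", OF assms(1) c y])
      (use adjacent_words_below[OF assms(2)] assms(3) in blast)
qed

text \<open>
  At most one branch set contains \<open>x\<close>; the remaining ones together form a connected set avoiding
  \<open>x\<close> because \<open>M\<close> has no cut-vertex, so they lie on one side of \<open>x\<close>.
\<close>

lemma minor_model_below:
  assumes "graph M" "Digraph_Component.connected M" "\<nexists>v. cut_vertex M v"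
    and X: "minor_model M E X" and E: "\<And>a b. E a b \<Longrightarrow> adjacent_words a b"
    and a: "a \<in> verts M" "x \<notin> X a" "X a \<inter> below t x \<noteq> {}"
    and b: "b \<in> verts M"
  shows "X b \<inter> insert x (below t x) \<noteq> {}"
proof -
  interpret graph M by fact
  define W where "W = {v \<in> verts M. x \<notin> X v}"
  have con: "connected_in (dominates M) W"
  proof (cases "W = verts M")
    case True
    then show ?thesis using connected_imp_connected_in[OF assms(2)] by simp
  next
    case False
    then obtain v where v: "v \<in> verts M" "x \<in> X v" by (auto simp: W_def)
    then have "W = verts M - {v}" using X unfolding W_def minor_model_def by blast
    moreover have "verts M \<noteq> {v}" using a v by auto
    ultimately show ?thesis using connected_in_del_vert[OF assms(2) _ v(1)] assms(3) by simp
  qed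
  show ?thesis
  proof (cases "x \<in> X b")
    case False
    have side: "X v \<subseteq> below t x" if "v \<in> W" "X v \<inter> below t x \<noteq> {}" for v
      by (rule connected_in_below[OF _ E]) (use that X in \<open>auto simp: W_def minor_model_def\<close>)
    have "X b \<subseteq> below t x"
    proof (rule connected_in_invariant[OF con])
      show "a \<in> W" "b \<in> W" using a b False by (auto simp: W_def)
      then show "X a \<subseteq> below t x" using side a(3) by blast
    next
      fix u v assume uv: "u \<rightarrow>\<^bsub>M\<^esub> v" "u \<in> W" "v \<in> W" "X u \<subseteq> below t x"
      \<comment> \<open>The model edge leaving \<open>X u\<close> ends in the branch or at
        \<open>x\<close>; the latter is excluded because \<open>v\<close> lies in
        \<open>W\<close>.\<close>
      then obtain y y' where "y \<in> X u" "y' \<in> X v" "E y y'" using X unfolding minor_model_def by blast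
      then have "y' \<in> X v \<inter> insert x (below t x)" using adjacent_words_below[OF E] uv(4) by blast
      then show "X v \<subseteq> below t x" using side uv(3) by (auto simp: W_def)
    qed
    moreover have "X b \<noteq> {}" using X b unfolding minor_model_def connected_in_def by blast
    ultimately show ?thesis by blast
  qed blast
qed

text \<open>
  Starting at the empty word, one descends in the tree of cosets towards the branch sets until
  the current coset meets all of them; branch sets that the coset misses lie strictly further
  down, which bounds the descent.
\<close>

lemma minor_model_meets_coset:
  assumes M: "graph M" "Digraph_Component.connected M" "\<nexists>v. cut_vertex M v"
    and X: "minor_model M E X" and E: "\<And>a b. E a b \<Longrightarrow> adjacent_words a b"
    and alt: "\<And>v y. v \<in> verts M \<Longrightarrow> y \<in> X v \<Longrightarrow> successively (\<lambda>a b. isl a \<noteq> isl b) y"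
  obtains t w where "w = [] \<or> isl (hd w) \<noteq> t"
    "\<forall>v\<in>verts M. X v \<inter> coset_words t w \<noteq> {}"
proof -
  have side: "X b \<inter> insert x (below t x) \<noteq> {}"
    if "a \<in> verts M" "x \<notin> X a" "X a \<inter> below t x \<noteq> {}" "b \<in> verts M" for a b x t
    by (rule minor_model_below[OF M X E that])
  have ne: "X v \<noteq> {}" and fin: "finite (X v)" if "v \<in> verts M" for v
    using X that by (auto simp: minor_model_def connected_in_def)
  interpret graph M by fact
  obtain v0 where v0: "v0 \<in> verts M"
    using M(2) connected_imp_connected_in[of "dominates M"] unfolding connected_in_def by blast
  \<comment> \<open>A single branch set bounds the depth: it must contain a word ending in the
    current base \<open>w\<close>.\<close>
  define N where "N = Max (length ` X v0)"
  define Q where "Q t w \<longleftrightarrow> (w = [] \<or> isl (hd w) \<noteq> t) \<and>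
     (\<forall>v\<in>verts M. X v \<inter> insert w (below t w) \<noteq> {})" for t and w :: "('c + 'd) list"
  have bound: "length w \<le> N" if Q: "Q t w" for t w
  proof -
    obtain y where y: "y \<in> X v0" "y = w \<or> y \<in> below t w" using Q v0 unfolding Q_def by blast
    then have "length w \<le> length y" by (auto simp: below_def)
    also have "\<dots> \<le> N" unfolding N_def using y(1) fin[OF v0] by simp
    finally show ?thesis .
  qed
  \<comment> \<open>The last letter of a word in a branch set avoiding \<open>[]\<close> tells which
    factor to enter first. If every branch set contains \<open>[]\<close>, either factor will
    do.\<close>
  have "\<exists>t. Q t []"
  proof (cases "\<exists>a\<in>verts M. [] \<notin> X a")
    case True
    then obtain a y where a: "a \<in> verts M" "[] \<notin> X a" "y \<in> X a" using ne by blast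
    then have "y = butlast y @ [last y]" by (metis append_butlast_last_id)
    then have "y \<in> below (isl (last y)) []" unfolding below_def by blast
    then have "Q (isl (last y)) []" unfolding Q_def using side a by blast
    then show ?thesis ..
  qed (auto simp: Q_def)
  then obtain t0 where t0: "Q t0 []" ..
  \<comment> \<open>The descent is replaced by an extremal choice: a base \<open>w\<close> of
    maximal length.\<close>
  define n where "n = (GREATEST n. \<exists>t w. Q t w \<and> length w = n)"
  have "\<exists>t w. Q t w \<and> length w = n"
    unfolding n_def by (rule GreatestI_nat[of _ 0 N]) (use t0 bound in auto)
  then obtain t w where tw: "Q t w" "length w = n" by blast
  have max: "length w' \<le> length w" if "Q t' w'" for t' w'
    unfolding tw(2) n_def by (rule Greatest_le_nat[of _ _ N]) (use that bound in auto)
  have "X v \<inter> coset_words t w \<noteq> {}" if v: "v \<in> verts M" for v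
  proof
    assume empty: "X v \<inter> coset_words t w = {}"
    then have "w \<notin> X v" by (auto simp: coset_words_def)
    then obtain z c where y: "z @ c # w \<in> X v" "isl c = t"
      using tw(1) v unfolding Q_def below_def by blast
    let ?x = "c # w"
    have "z \<noteq> []" using y empty by (auto simp: coset_words_def)
    then have z: "z @ c # w = butlast z @ last z # ?x" by simp
    \<comment> \<open>Letters alternate between the factors, so the next coset, based at
      \<open>c # w\<close>, belongs to the other factor.\<close>
    then have "isl (last z) \<noteq> t"
      using alt[OF v y(1)] y(2) \<open>z \<noteq> []\<close> by (auto simp: successively_append_iff)
    then have "z @ c # w \<in> below (\<not> t) ?x" using z unfolding below_def by blast
    moreover have "?x \<notin> X v" using empty y(2) by (auto simp: coset_words_def)
    ultimately have "Q (\<not> t) ?x" unfolding Q_def using side[OF v] y by auto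
    then show False using max by fastforce
  qed
  then show ?thesis using that tw(1) unfolding Q_def by blast
qed

text \<open>Collapsing edges does no harm to connectedness. An edge joining two branch sets cannot
  collapse, since their images are disjoint; an edge of \<open>M\<close> joins distinct vertices
  because \<open>M\<close> has no loops.\<close>

lemma minor_model_image:
  assumes X: "minor_model M E X"
    and hom: "\<And>u v x y. u \<in> verts M \<Longrightarrow> v \<in> verts M \<Longrightarrow> x \<in> X u \<Longrightarrow> y \<in> X v \<Longrightarrow> E x y \<Longrightarrow>
      \<rho> x = \<rho> y \<or> E' (\<rho> x) (\<rho> y)"
    and disj: "\<And>u v. u \<in> verts M \<Longrightarrow> v \<in> verts M \<Longrightarrow> u \<noteq> v \<Longrightarrow> \<rho> ` X u \<inter> \<rho> ` X v = {}"
    and "loopfree_digraph M"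
  shows "minor_model M E' (\<lambda>v. \<rho> ` X v)"
proof -
  interpret loopfree_digraph M by fact
  have "connected_in E' (\<rho> ` X v)" if v: "v \<in> verts M" for v
  proof -
    let ?R = "\<lambda>a b. E' a b \<and> a \<in> \<rho> ` X v \<and> b \<in> \<rho> ` X v"
    have con: "connected_in E (X v)" using X v by (auto simp: minor_model_def)
    have "?R\<^sup>*\<^sup>* (\<rho> x) (\<rho> y)" if "x \<in> X v" "y \<in> X v" for x y
    proof (rule connected_in_invariant[OF con that(1) _ that(2)])
      fix a b assume ab: "E a b" "a \<in> X v" "b \<in> X v" "?R\<^sup>*\<^sup>* (\<rho> x) (\<rho> a)"
      then have "\<rho> a = \<rho> b \<or> ?R (\<rho> a) (\<rho> b)" using hom[OF v v] by blast
      then show "?R\<^sup>*\<^sup>* (\<rho> x) (\<rho> b)" using ab(4) by (metis (no_types, lifting) rtranclp.rtrancl_into_rtrancl)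
    qed simp
    then show ?thesis using con by (auto simp: connected_in_def)
  qed
  moreover have "\<exists>x\<in>\<rho> ` X u. \<exists>y\<in>\<rho> ` X v. E' x y" if uv: "u \<rightarrow>\<^bsub>M\<^esub> v" for u v
  proof -
    have V: "u \<in> verts M" "v \<in> verts M" "u \<noteq> v" using uv adj_in_verts adj_not_same by blast+
    obtain x y where xy: "x \<in> X u" "y \<in> X v" "E x y" using X uv unfolding minor_model_def by blast
    then have "\<rho> x \<noteq> \<rho> y" using disj[OF V] by blast
    then show ?thesis using hom[OF V(1,2) xy] xy by blast
  qed
  moreover have "finite (\<rho> ` X v)" if "v \<in> verts M" for v
    using X that by (simp add: minor_model_def)
  ultimately show ?thesis
    unfolding minor_model_def using disj by simp
qed

text \<open>The new model is the image under the gate followed by the coordinate map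
  \<open>\<pi>\<close>. Gates stay inside their own branch sets, so injectivity of
  \<open>\<pi>\<close> on the coset suffices for disjointness.\<close>

lemma minor_model_project_coset:
  assumes "loopfree_digraph M" and X: "minor_model M E X"
    and E: "\<And>a b. E a b \<Longrightarrow> adjacent_words a b"
    and V: "\<And>v. v \<in> verts M \<Longrightarrow> X v \<subseteq> V"
    and meets: "\<And>v. v \<in> verts M \<Longrightarrow> X v \<inter> coset_words t w \<noteq> {}"
    and inj: "inj_on \<pi> (coset_words t w \<inter> V)"
    and hom: "\<And>y y'. y \<in> coset_words t w \<inter> V \<Longrightarrow> y' \<in> coset_words t w \<inter> V \<Longrightarrow> E y y' \<Longrightarrow>
      E' (\<pi> y) (\<pi> y')"
  obtains Y where "minor_model M E' Y"
    "\<forall>v\<in>verts M. Y v \<subseteq> \<pi> ` (coset_words t w \<inter> V)"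
proof
  have gate: "gate t w y \<in> X v" if "v \<in> verts M" "y \<in> X v" for v y
    by (rule connected_in_gate[OF _ E meets]) (use X that in \<open>auto simp: minor_model_def\<close>)
  show "minor_model M E' (\<lambda>v. (\<lambda>y. \<pi> (gate t w y)) ` X v)"
  proof (rule minor_model_image[OF X _ _ assms(1)])
    fix u v x y assume "u \<in> verts M" "v \<in> verts M" "x \<in> X u" "y \<in> X v" "E x y"
    moreover from this V have "x \<in> V" "y \<in> V" by blast+
    ultimately show "\<pi> (gate t w x) = \<pi> (gate t w y) \<or> E' (\<pi> (gate t w x)) (\<pi> (gate t w y))"
      using adjacent_words_gate[OF E, of x y t w] hom[of x y] gate_coset[of x t w]
        gate_coset[of y t w] by auto
  next
    fix u v assume uv: "u \<in> verts M" "v \<in> verts M" "u \<noteq> v"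
    then have disj: "X u \<inter> X v = {}" using X by (auto simp: minor_model_def)
    have coset: "gate t w y \<in> coset_words t w \<inter> V" if "v \<in> verts M" "y \<in> X v" for v y
      using gate[OF that] gate_in_coset V[OF that(1)] by blast
    have "\<pi> (gate t w x) \<noteq> \<pi> (gate t w y)" if xy: "x \<in> X u" "y \<in> X v" for x y
    proof
      assume "\<pi> (gate t w x) = \<pi> (gate t w y)"
      then have "gate t w x = gate t w y"
        by (rule inj_onD[OF inj _ coset[OF uv(1) xy(1)] coset[OF uv(2) xy(2)]])
      then show False using gate[OF uv(1) xy(1)] gate[OF uv(2) xy(2)] disj by auto
    qed
    then show "(\<lambda>y. \<pi> (gate t w y)) ` X u \<inter> (\<lambda>y. \<pi> (gate t w y)) ` X v = {}"
      by blast
  qed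
  show "\<forall>v\<in>verts M. (\<lambda>y. \<pi> (gate t w y)) ` X v \<subseteq> \<pi> ` (coset_words t w \<inter> V)"
    using gate V gate_in_coset by fast
qed

section \<open>The Cayley graph of a free product\<close>

lemma not_isl_iff: "\<not> isl x \<longleftrightarrow> (\<exists>b. x = Inr b)"
  by (cases x) auto

text \<open>Generators are not the identity, so each embeds as a one-letter word and acts by a
  single syllable multiplication.\<close>

lemma free_product_cayley_adjE:
  assumes "cayley_generating_set G S" "cayley_generating_set H T"
    and "y \<rightarrow>\<^bsub>cayley_graph (free_product G H) (free_product_inl G ` S \<union> free_product_inr H ` T)\<^esub> y'"
  obtains (Inl) s where "s \<in> S" "y = syllable_mult G H (Inl s) y'"
    | (Inr) s where "s \<in> T" "y = syllable_mult G H (Inr s) y'"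
  using assms(3) cayley_generating_setD(2)[OF assms(1)] cayley_generating_setD(2)[OF assms(2)]
  by (auto simp: cayley_graph_adj free_product_def free_product_inl_def free_product_inr_def
      split: if_splits)

lemma adjacent_words_syllable_mult: "adjacent_words (syllable_mult G H x w) w"
  by (cases "(G, H, x, w)" rule: syllable_mult.cases) (auto simp: adjacent_words_def)

text \<open>Here \<open>K\<close> is whichever factor the coset belongs to, and \<open>\<pi>\<close>
  identifies points of the coset with elements of \<open>K\<close>.\<close>

lemma minor_model_coset_imp_is_minor:
  assumes "group K" "cayley_generating_set K R" "loopfree_digraph M" "minor_model M E X"
    and "\<And>a b. E a b \<Longrightarrow> adjacent_words a b"
    and "\<And>v. v \<in> verts M \<Longrightarrow> X v \<subseteq> V"
    and "\<And>v. v \<in> verts M \<Longrightarrow> X v \<inter> coset_words t w \<noteq> {}"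
    and "inj_on \<pi> (coset_words t w \<inter> V)"
    and closed: "\<pi> ` (coset_words t w \<inter> V) \<subseteq> carrier K"
    and adj: "\<And>y y'. y \<in> coset_words t w \<inter> V \<Longrightarrow> y' \<in> coset_words t w \<inter> V \<Longrightarrow> E y y' \<Longrightarrow>
      \<exists>s\<in>R. \<pi> y = s \<otimes>\<^bsub>K\<^esub> \<pi> y'"
  shows "is_minor M (cayley_graph K R)"
proof -
  obtain Y where "minor_model M (dominates (cayley_graph K R)) Y"
    and "\<forall>v\<in>verts M. Y v \<subseteq> \<pi> ` (coset_words t w \<inter> V)"
  proof (rule minor_model_project_coset[OF assms(3-8)])
    fix y y' assume y: "y \<in> coset_words t w \<inter> V" "y' \<in> coset_words t w \<inter> V" "E y y'"
    show "\<pi> y \<rightarrow>\<^bsub>cayley_graph K R\<^esub> \<pi> y'"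
      unfolding cayley_graph_adj using adj[OF y] closed y(1,2) by blast
  qed blast
  then show ?thesis
    using minor_model_cayley_graph[OF assms(1,2)] closed by blast
qed

theorem theorem3p8:
  fixes G :: "('a, 'c) monoid_scheme" and H :: "('b, 'd) monoid_scheme"
    and S :: "'a set" and T :: "'b set"
    and M :: "('v, 'e) pre_digraph"
  assumes "group G" and "group H"
    and "cayley_generating_set G S" and "cayley_generating_set H T"
    and "graph M" and "Digraph_Component.connected M"
    and "\<nexists>v. cut_vertex M v"
    and "is_minor M (cayley_graph (free_product G H) (free_product_inl G ` S \<union> free_product_inr H ` T))"
  shows "is_minor M (cayley_graph G S) \<or> is_minor M (cayley_graph H T)"
proof -
  interpret G: group G by fact
  interpret H: group H by fact
  interpret M: graph M by fact
  have loopfree: "loopfree_digraph M" by unfold_locales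
  let ?C = "cayley_graph (free_product G H) (free_product_inl G ` S \<union> free_product_inr H ` T)"
  obtain X where X: "minor_model M (dominates ?C) X"
    and "\<And>v. v \<in> verts M \<Longrightarrow> X v \<subseteq> verts ?C"
    using is_minor_imp_minor_model[OF assms(8)] by blast
  then have V: "X v \<subseteq> reduced_words G H" if "v \<in> verts M" for v
    using that by (simp add: cayley_graph_def free_product_def)
  note adjE = free_product_cayley_adjE[OF assms(3,4)]
  have E: "adjacent_words y y'" if "y \<rightarrow>\<^bsub>?C\<^esub> y'" for y y'
    using adjE[OF that] adjacent_words_syllable_mult by metis
  obtain t w where w: "w = [] \<or> isl (hd w) \<noteq> t"
    and "\<forall>v\<in>verts M. X v \<inter> coset_words t w \<noteq> {}"
  proof (rule minor_model_meets_coset[OF assms(5-7) X E])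
    fix v y assume "v \<in> verts M" "y \<in> X v"
    then show "successively (\<lambda>a b. isl a \<noteq> isl b) y"
      using V by (auto simp: reduced_words_def)
  qed blast
  then have meets: "X v \<inter> coset_words t w \<noteq> {}" if "v \<in> verts M" for v using that by blast
  show ?thesis
  proof (cases t)
    case True
    \<comment> \<open>A coset point \<open>y\<close> is read as the element \<open>g\<close> of
      \<open>G\<close> that carries \<open>w\<close> to \<open>y\<close>; the base \<open>w\<close>
      itself gives the identity.\<close>
    let ?\<pi> = "\<lambda>y. if y = w then \<one>\<^bsub>G\<^esub> else projl (hd y)"
    have coset: "y = w \<or> (\<exists>g\<in>carrier G. g \<noteq> \<one>\<^bsub>G\<^esub> \<and> y = Inl g # w)"
      if "y \<in> coset_words t w \<inter> reduced_words G H" for y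
      using that True by (auto simp: coset_words_def isl_def reduced_words_Cons)
    have "is_minor M (cayley_graph G S)"
    proof (rule minor_model_coset_imp_is_minor[OF assms(1,3) loopfree X E V meets])
      show "inj_on ?\<pi> (coset_words t w \<inter> reduced_words G H)"
        by (rule inj_onI, drule coset, drule coset) (auto split: if_splits)
      show "?\<pi> ` (coset_words t w \<inter> reduced_words G H) \<subseteq> carrier G"
        using coset by fastforce
      fix y y' assume y: "y \<in> coset_words t w \<inter> reduced_words G H"
        "y' \<in> coset_words t w \<inter> reduced_words G H" and "y \<rightarrow>\<^bsub>?C\<^esub> y'"
      from adjE[OF this(3)]
      consider (Inl) s where "s \<in> S" "y = syllable_mult G H (Inl s) y'"
        | (Inr) s where "s \<in> T" "y = syllable_mult G H (Inr s) y'" by blast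
      then show "\<exists>s\<in>S. ?\<pi> y = s \<otimes>\<^bsub>G\<^esub> ?\<pi> y'"
      proof cases
        case (Inl s)
        have "s \<in> carrier G" using cayley_generating_setD(1)[OF assms(3) Inl(1)] .
        \<comment> \<open>Since \<open>w\<close> does not begin with a letter from \<open>G\<close>,
          nothing merges and \<open>s\<close> is prepended.\<close>
        moreover have "syllable_mult G H (Inl s) w = Inl s # w"
          using w True by (cases "(G, H, Inl s :: 'a + 'b, w)" rule: syllable_mult.cases) auto
        ultimately have "?\<pi> y = s \<otimes>\<^bsub>G\<^esub> ?\<pi> y'"
          using Inl(2) coset[OF y(2)] by (auto split: if_splits)
        then show ?thesis using Inl(1) by blast
      next
        case (Inr s)
        \<comment> \<open>A generator of \<open>H\<close> applied to \<open>Inl g # w\<close> leaves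
          the coset. Applied to \<open>w\<close> it could stay only by fixing \<open>w\<close>,
          which cancellation rules out because \<open>s\<close> is not the identity.\<close>
        have False
          using Inr(2) y coset[OF y(1)] coset[OF y(2)] cayley_generating_setD[OF assms(4) Inr(1)]
          by (cases "(G, H, Inr s :: 'a + 'b, y')" rule: syllable_mult.cases)
            (auto simp: reduced_words_Cons H.r_cancel_one' split: if_splits)
        then show ?thesis ..
      qed
    qed
    then show ?thesis ..
  next
    case False
    \<comment> \<open>The mirror image, with the factors exchanged: \<open>w\<close> is read as the
      identity of \<open>H\<close>.\<close>
    let ?\<pi> = "\<lambda>y. if y = w then \<one>\<^bsub>H\<^esub> else projr (hd y)"
    have coset: "y = w \<or> (\<exists>g\<in>carrier H. g \<noteq> \<one>\<^bsub>H\<^esub> \<and> y = Inr g # w)"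
      if "y \<in> coset_words t w \<inter> reduced_words G H" for y
      using that False by (auto simp: coset_words_def not_isl_iff reduced_words_Cons)
    have "is_minor M (cayley_graph H T)"
    proof (rule minor_model_coset_imp_is_minor[OF assms(2,4) loopfree X E V meets])
      show "inj_on ?\<pi> (coset_words t w \<inter> reduced_words G H)"
        by (rule inj_onI, drule coset, drule coset) (auto split: if_splits)
      show "?\<pi> ` (coset_words t w \<inter> reduced_words G H) \<subseteq> carrier H"
        using coset by fastforce
      fix y y' assume y: "y \<in> coset_words t w \<inter> reduced_words G H"
        "y' \<in> coset_words t w \<inter> reduced_words G H" and "y \<rightarrow>\<^bsub>?C\<^esub> y'"
      from adjE[OF this(3)]
      consider (Inl) s where "s \<in> S" "y = syllable_mult G H (Inl s) y'"
        | (Inr) s where "s \<in> T" "y = syllable_mult G H (Inr s) y'" by blast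
      then show "\<exists>s\<in>T. ?\<pi> y = s \<otimes>\<^bsub>H\<^esub> ?\<pi> y'"
      proof cases
        case (Inl s)
        have False
          using Inl(2) y coset[OF y(1)] coset[OF y(2)] cayley_generating_setD[OF assms(3) Inl(1)]
          by (cases "(G, H, Inl s :: 'a + 'b, y')" rule: syllable_mult.cases)
            (auto simp: reduced_words_Cons G.r_cancel_one' split: if_splits)
        then show ?thesis ..
      next
        case (Inr s)
        have "s \<in> carrier H" using cayley_generating_setD(1)[OF assms(4) Inr(1)] .
        moreover have "syllable_mult G H (Inr s) w = Inr s # w"
          using w False by (cases "(G, H, Inr s :: 'a + 'b, w)" rule: syllable_mult.cases) auto
        ultimately have "?\<pi> y = s \<otimes>\<^bsub>H\<^esub> ?\<pi> y'"
          using Inr(2) coset[OF y(2)] by (auto split: if_splits)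
        then show ?thesis using Inr(1) by blast
      qed
    qed
    then show ?thesis ..
  qed
qed

end
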